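(* Let $A$ be a Banach algebra with a bounded approximate identity and let $B$ be a left Banach $A$-module with action $\pi_\ell:A\times B\to B$. (1) If $B^*$ factors on the left (i.e. $B^*A=B^*$) and $B^{**}$ has a left unit as an $A^{**}$-module, then $(B^*A)^\perp=0$. (2) If $B^*$ does not factor on the left (i.e. $B^*A\ne B^*$) and $e''$ is a left unit for $B^{**}$ as an $A^{**}$-module, then $e''\notin Z_{B^{**}}(A^{**})$.
   Context: For $b'\in B^*$, $a\in A$, $b'a=\pi_\ell^*(b',a)\in B^*$ is defined by $\langle b'a,b\rangle=\langle b',ab\rangle$. $B^*A=\{b'a: b'\in B^*, a\in A\}$ and $(B^*A)^\perp$ is its annihilator in $B^{**}$. For $b''\in B^{**}$, $\pi_\ell^{**}(b'',b')\in A^*$ is given by $\langle\pi_\ell^{**}(b'',b'),a\rangle=\langle b'',b'a\rangle$, and for $a''\in A^{**}$, $\pi_\ell^{***}(a'',b'')\in B^{**}$ by $\langle\pi_\ell^{***}(a'',b''),b'\rangle=\langle a'',\pi_\ell^{**}(b'',b')\rangle$. $A^{**}$ carries the first Arens product (the case $B=A$) and $B^{**}$ is a left $A^{**}$-module via $\pi_\ell^{***}$. A left unit for $B^{**}$ as an $A^{**}$-module is an element $e''\in A^{**}$ that is a left unit of $A^{**}$ and satisfies $\pi_\ell^{***}(e'',b'')=b''$ for all $b''\in B^{**}$. $Z_{B^{**}}(A^{**})=\{a''\in A^{**}: b''\mapsto \pi_\ell^{***}(a'',b'')\text{ is weak}^*\text{-to-weak}^*\text{ continuous on }B^{**}\}$.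 *)

theory Defs
  imports "HOL-Analysis.Analysis"
begin

text \<open>
  The scalar type ranges over the sort \<open>{real_normed_field, euclidean_space}\<close>. Both \<^typ>\<open>real\<close> and
  \<^typ>\<open>complex\<close> have this sort, and up to isomorphism they are its only members (a
  finite-dimensional field extension of the reals), so real and complex Banach algebras are treated
  at once. The library's class \<^class>\<open>banach\<close> only knows real scalars; the scalar multiplication
  over \<open>'k\<close> is an explicit parameter that extends the real one.
\<close>

locale banach_space_over = vector_space scl
  for scl :: "'k::{real_normed_field,euclidean_space} \<Rightarrow> 'x::banach \<Rightarrow> 'x" +
  assumes scale_of_real: "scl (of_real r) x = r *\<^sub>R x"
    and norm_scale: "norm (scl c x) = norm c * norm x"

locale banach_algebra_over = banach_space_over scl
  for scl :: "'k::{real_normed_field,euclidean_space} \<Rightarrow> 'a::{real_normed_algebra,banach} \<Rightarrow> 'a" +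
  assumes scale_mult_left: "scl c x * y = scl c (x * y)"
    and scale_mult_right: "x * scl c y = scl c (x * y)"

locale left_banach_module =
  A: banach_algebra_over scaleA + B: banach_space_over scaleB + bounded_bilinear act
  for scaleA :: "'k::{real_normed_field,euclidean_space} \<Rightarrow> 'a::{real_normed_algebra,banach} \<Rightarrow> 'a"
    and scaleB :: "'k \<Rightarrow> 'b::banach \<Rightarrow> 'b"
    and act :: "'a \<Rightarrow> 'b \<Rightarrow> 'b" +
  assumes act_mult: "act (x * y) b = act x (act y b)"
    and act_scale_left: "act (scaleA c x) b = scaleB c (act x b)"
    and act_scale_right: "act x (scaleB c b) = scaleB c (act x b)"

text \<open>A net is a family together with a proper filter on its index type (for a directed index set,
  the filter generated by its final sections).\<close>

definition bounded_approximate_identity :: "('i \<Rightarrow> 'a::real_normed_algebra) \<Rightarrow> 'i filter \<Rightarrow> bool" where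
  "bounded_approximate_identity e F \<longleftrightarrow>
     F \<noteq> bot \<and> (\<exists>M. \<forall>i. norm (e i) \<le> M) \<and>
     (\<forall>a. ((\<lambda>i. e i * a) \<longlongrightarrow> a) F \<and> ((\<lambda>i. a * e i) \<longlongrightarrow> a) F)"

text \<open>A dual space is the set of those real-bounded-linear maps into the scalars that are
  linear over \<open>'k\<close>; the norm of \<^typ>\<open>'x \<Rightarrow>\<^sub>L 'k\<close> is the usual dual norm.\<close>

definition dual :: "('k::{real_normed_field,euclidean_space} \<Rightarrow> 'x::banach \<Rightarrow> 'x) \<Rightarrow> ('x \<Rightarrow>\<^sub>L 'k) set" where
  "dual scl = {f. \<forall>c x. blinfun_apply f (scl c x) = c * blinfun_apply f x}"

text \<open>The dual is a subset of its type, so second-dual elements are functions on that subset; being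
  extensional (\<^term>\<open>undefined\<close> elsewhere) makes equality of functions equality of functionals.\<close>

definition bidual ::
    "('k::{real_normed_field,euclidean_space} \<Rightarrow> 'x::banach \<Rightarrow> 'x) \<Rightarrow> (('x \<Rightarrow>\<^sub>L 'k) \<Rightarrow> 'k) set" where
  "bidual scl = {\<phi> \<in> extensional (dual scl).
     (\<forall>f\<in>dual scl. \<forall>g\<in>dual scl. \<phi> (f + g) = \<phi> f + \<phi> g) \<and>
     (\<forall>c. \<forall>f\<in>dual scl. \<phi> (Blinfun (\<lambda>x. c * blinfun_apply f x)) = c * \<phi> f) \<and>
     (\<exists>K. \<forall>f\<in>dual scl. norm (\<phi> f) \<le> K * norm f)}"

definition bidual_zero ::
    "('k::{real_normed_field,euclidean_space} \<Rightarrow> 'x::banach \<Rightarrow> 'x) \<Rightarrow> ('x \<Rightarrow>\<^sub>L 'k) \<Rightarrow> 'k" where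
  "bidual_zero scl = (\<lambda>f\<in>dual scl. 0)"

definition annihilator ::
    "('k::{real_normed_field,euclidean_space} \<Rightarrow> 'x::banach \<Rightarrow> 'x) \<Rightarrow> ('x \<Rightarrow>\<^sub>L 'k) set
      \<Rightarrow> (('x \<Rightarrow>\<^sub>L 'k) \<Rightarrow> 'k) set" where
  "annihilator scl S = {\<phi> \<in> bidual scl. \<forall>f\<in>S. \<phi> f = 0}"

text \<open>The weak* topology on the second dual: pointwise convergence on the dual.\<close>

definition weak_star ::
    "('k::{real_normed_field,euclidean_space} \<Rightarrow> 'x::banach \<Rightarrow> 'x) \<Rightarrow> (('x \<Rightarrow>\<^sub>L 'k) \<Rightarrow> 'k) topology" where
  "weak_star scl =
     subtopology (product_topology (\<lambda>_. euclidean) (dual scl)) (bidual scl)"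

text \<open>The three successive adjoints of a module action
  \<open>\<pi>\<close>: \<open>\<langle>\<pi>\<^sup>*(b', a), b\<rangle> = \<langle>b', \<pi>(a, b)\<rangle>\<close>, \<open>\<langle>\<pi>\<^sup>*\<^sup>*(b'', b'), a\<rangle> = \<langle>b'', \<pi>\<^sup>*(b', a)\<rangle>\<close> and
  \<open>\<langle>\<pi>\<^sup>*\<^sup>*\<^sup>*(a'', b''), b'\<rangle> = \<langle>a'', \<pi>\<^sup>*\<^sup>*(b'', b')\<rangle>\<close>.\<close>

definition adj1 :: "('a::banach \<Rightarrow> 'b::banach \<Rightarrow> 'b) \<Rightarrow> ('b \<Rightarrow>\<^sub>L 'k::real_normed_field) \<Rightarrow> 'a \<Rightarrow> ('b \<Rightarrow>\<^sub>L 'k)" where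
  "adj1 act b' a = Blinfun (\<lambda>b. blinfun_apply b' (act a b))"

definition adj2 ::
    "('a::banach \<Rightarrow> 'b::banach \<Rightarrow> 'b) \<Rightarrow> (('b \<Rightarrow>\<^sub>L 'k::real_normed_field) \<Rightarrow> 'k) \<Rightarrow> ('b \<Rightarrow>\<^sub>L 'k) \<Rightarrow> ('a \<Rightarrow>\<^sub>L 'k)" where
  "adj2 act b'' b' = Blinfun (\<lambda>a. b'' (adj1 act b' a))"

definition adj3 ::
    "('k::{real_normed_field,euclidean_space} \<Rightarrow> 'b::banach \<Rightarrow> 'b) \<Rightarrow> ('a::banach \<Rightarrow> 'b \<Rightarrow> 'b)
      \<Rightarrow> (('a \<Rightarrow>\<^sub>L 'k) \<Rightarrow> 'k) \<Rightarrow> (('b \<Rightarrow>\<^sub>L 'k) \<Rightarrow> 'k) \<Rightarrow> (('b \<Rightarrow>\<^sub>L 'k) \<Rightarrow> 'k)" where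
  "adj3 scaleB act a'' b'' = (\<lambda>b'\<in>dual scaleB. a'' (adj2 act b'' b'))"

definition first_arens ::
    "('k::{real_normed_field,euclidean_space} \<Rightarrow> 'a::{real_normed_algebra,banach} \<Rightarrow> 'a)
      \<Rightarrow> (('a \<Rightarrow>\<^sub>L 'k) \<Rightarrow> 'k) \<Rightarrow> (('a \<Rightarrow>\<^sub>L 'k) \<Rightarrow> 'k) \<Rightarrow> (('a \<Rightarrow>\<^sub>L 'k) \<Rightarrow> 'k)" where
  "first_arens scaleA = adj3 scaleA (*)"

text \<open>The set \<open>B\<^sup>*A\<close> of products, not its linear span.\<close>

definition dual_times ::
    "('k::{real_normed_field,euclidean_space} \<Rightarrow> 'b::banach \<Rightarrow> 'b) \<Rightarrow> ('a::banach \<Rightarrow> 'b \<Rightarrow> 'b) \<Rightarrow> ('b \<Rightarrow>\<^sub>L 'k) set" where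
  "dual_times scaleB act = {adj1 act b' a | b' a. b' \<in> dual scaleB}"

definition factors_on_left ::
    "('k::{real_normed_field,euclidean_space} \<Rightarrow> 'b::banach \<Rightarrow> 'b) \<Rightarrow> ('a::banach \<Rightarrow> 'b \<Rightarrow> 'b) \<Rightarrow> bool" where
  "factors_on_left scaleB act \<longleftrightarrow> dual_times scaleB act = dual scaleB"

definition left_unit ::
    "('k::{real_normed_field,euclidean_space} \<Rightarrow> 'a::{real_normed_algebra,banach} \<Rightarrow> 'a)
      \<Rightarrow> ('k \<Rightarrow> 'b::banach \<Rightarrow> 'b) \<Rightarrow> ('a \<Rightarrow> 'b \<Rightarrow> 'b) \<Rightarrow> (('a \<Rightarrow>\<^sub>L 'k) \<Rightarrow> 'k) \<Rightarrow> bool" where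
  "left_unit scaleA scaleB act e'' \<longleftrightarrow>
     e'' \<in> bidual scaleA \<and>
     (\<forall>a''\<in>bidual scaleA. first_arens scaleA e'' a'' = a'') \<and>
     (\<forall>b''\<in>bidual scaleB. adj3 scaleB act e'' b'' = b'')"

definition topological_centre ::
    "('k::{real_normed_field,euclidean_space} \<Rightarrow> 'a::{real_normed_algebra,banach} \<Rightarrow> 'a)
      \<Rightarrow> ('k \<Rightarrow> 'b::banach \<Rightarrow> 'b) \<Rightarrow> ('a \<Rightarrow> 'b \<Rightarrow> 'b) \<Rightarrow> (('a \<Rightarrow>\<^sub>L 'k) \<Rightarrow> 'k) set" where
  "topological_centre scaleA scaleB act =
     {a'' \<in> bidual scaleA.
        continuous_map (weak_star scaleB) (weak_star scaleB) (adj3 scaleB act a'')}"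

text \<open>The arguments of \<^const>\<open>Blinfun\<close> above are bounded linear, and the adjoints take values in the
  intended spaces.\<close>

lemma topspace_weak_star: "topspace (weak_star scl) = bidual scl"
  by (auto simp: weak_star_def bidual_def PiE_def)

lemma scale_dual_apply:
  fixes f :: "'x::banach \<Rightarrow>\<^sub>L 'k::real_normed_field"
  shows "blinfun_apply (Blinfun (\<lambda>x. c * blinfun_apply f x)) x = c * blinfun_apply f x"
  by (subst bounded_linear_Blinfun_apply)
    (auto intro: bounded_linear_const_mult blinfun.bounded_linear_right)

context left_banach_module
begin

lemma adj1_apply: "blinfun_apply (adj1 act b' a) b = blinfun_apply b' (act a b)"
  for b' :: "'b \<Rightarrow>\<^sub>L 'k"
  unfolding adj1_def
  by (subst bounded_linear_Blinfun_apply)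
    (auto intro: bounded_linear_compose blinfun.bounded_linear_right bounded_linear_right)

lemma adj1_in_dual: "b' \<in> dual scaleB \<Longrightarrow> adj1 act b' a \<in> dual scaleB"
  by (auto simp: dual_def adj1_apply act_scale_right)

lemma bounded_linear_adj2:
  assumes b'': "b'' \<in> bidual scaleB" and b': "b' \<in> dual scaleB"
  shows "bounded_linear (\<lambda>a. b'' (adj1 act b' a))"
proof -
  obtain K where K: "\<And>f. f \<in> dual scaleB \<Longrightarrow> norm (b'' f) \<le> K * norm f"
    using b'' unfolding bidual_def by blast
  obtain L where L: "\<And>a b. norm (act a b) \<le> norm a * norm b * L" and "L \<ge> 0"
    using nonneg_bounded by blast
  have add: "adj1 act b' (x + y) = adj1 act b' x + adj1 act b' y" for x y
    by (rule blinfun_eqI) (simp add: adj1_apply plus_blinfun.rep_eq add_left blinfun.add_right)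
  have sc: "adj1 act b' (r *\<^sub>R x) = Blinfun (\<lambda>b. of_real r * blinfun_apply (adj1 act b' x) b)" for r x
    by (rule blinfun_eqI)
      (unfold scale_dual_apply, simp add: adj1_apply scaleR_left blinfun.scaleR_right scaleR_conv_of_real)
  have nb: "norm (adj1 act b' a) \<le> norm b' * L * norm a" for a
  proof (rule norm_blinfun_bound)
    show "0 \<le> norm b' * L * norm a" using \<open>L \<ge> 0\<close> by simp
    show "norm (blinfun_apply (adj1 act b' a) b) \<le> norm b' * L * norm a * norm b" for b
    proof -
      have "norm (blinfun_apply b' (act a b)) \<le> norm b' * norm (act a b)" by (rule norm_blinfun)
      also have "\<dots> \<le> norm b' * (norm a * norm b * L)" by (intro mult_left_mono L) auto
      finally show ?thesis by (simp add: adj1_apply mult_ac)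
    qed
  qed
  show ?thesis
  proof (rule bounded_linear_intro[where K = "\<bar>K\<bar> * (norm b' * L)"])
    show "b'' (adj1 act b' (x + y)) = b'' (adj1 act b' x) + b'' (adj1 act b' y)" for x y
      using b'' adj1_in_dual[OF b'] by (auto simp: add bidual_def)
    show "b'' (adj1 act b' (r *\<^sub>R x)) = r *\<^sub>R b'' (adj1 act b' x)" for r x
      using b'' adj1_in_dual[OF b'] by (auto simp: sc bidual_def scaleR_conv_of_real)
    show "norm (b'' (adj1 act b' x)) \<le> norm x * (\<bar>K\<bar> * (norm b' * L))" for x
    proof -
      have "norm (b'' (adj1 act b' x)) \<le> K * norm (adj1 act b' x)"
        by (rule K[OF adj1_in_dual[OF b']])
      also have "\<dots> \<le> \<bar>K\<bar> * (norm b' * L * norm x)"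
        by (intro mult_mono nb) auto
      finally show ?thesis by (simp add: mult_ac)
    qed
  qed
qed

lemma adj2_apply:
  assumes "b'' \<in> bidual scaleB" and "b' \<in> dual scaleB"
  shows "blinfun_apply (adj2 act b'' b') a = b'' (adj1 act b' a)"
  unfolding adj2_def by (simp add: bounded_linear_Blinfun_apply bounded_linear_adj2 assms)

lemma adj2_in_dual:
  assumes "b'' \<in> bidual scaleB" and "b' \<in> dual scaleB"
  shows "adj2 act b'' b' \<in> dual scaleA"
proof -
  have "adj1 act b' (scaleA c x) = Blinfun (\<lambda>b. c * blinfun_apply (adj1 act b' x) b)" for c x
    using assms(2)
    by (intro blinfun_eqI) (unfold scale_dual_apply, simp add: adj1_apply act_scale_left dual_def)
  then show ?thesis
    using assms adj1_in_dual[OF assms(2)] by (auto simp: dual_def[of scaleA] adj2_apply bidual_def)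
qed

lemma adj3_in_bidual:
  assumes a'': "a'' \<in> bidual scaleA" and b'': "b'' \<in> bidual scaleB"
  shows "adj3 scaleB act a'' b'' \<in> bidual scaleB"
proof -
  have dadd: "f + g \<in> dual scaleB" if "f \<in> dual scaleB" "g \<in> dual scaleB" for f g :: "'b \<Rightarrow>\<^sub>L 'k"
    using that by (simp add: dual_def plus_blinfun.rep_eq distrib_left)
  have dsc: "Blinfun (\<lambda>x. c * blinfun_apply f x) \<in> dual scaleB"
    if "f \<in> dual scaleB" for f :: "'b \<Rightarrow>\<^sub>L 'k" and c
    using that by (simp add: dual_def scale_dual_apply mult_ac)
  obtain K where K: "\<And>f. f \<in> dual scaleA \<Longrightarrow> norm (a'' f) \<le> K * norm f"
    using a'' unfolding bidual_def by blast
  obtain M where M: "\<And>f. f \<in> dual scaleB \<Longrightarrow> norm (b'' f) \<le> M * norm f"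
    using b'' unfolding bidual_def by blast
  obtain L where L: "\<And>a b. norm (act a b) \<le> norm a * norm b * L" and "L \<ge> 0"
    using nonneg_bounded by blast
  have add: "adj2 act b'' (f + g) = adj2 act b'' f + adj2 act b'' g"
    if fg: "f \<in> dual scaleB" "g \<in> dual scaleB" for f g
  proof (rule blinfun_eqI)
    fix a
    have "adj1 act (f + g) a = adj1 act f a + adj1 act g a"
      by (rule blinfun_eqI) (simp add: adj1_apply plus_blinfun.rep_eq)
    then show "blinfun_apply (adj2 act b'' (f + g)) a = blinfun_apply (adj2 act b'' f + adj2 act b'' g) a"
      using b'' fg adj1_in_dual
      by (simp add: adj2_apply dadd plus_blinfun.rep_eq) (simp add: bidual_def)
  qed
  have sc: "adj2 act b'' (Blinfun (\<lambda>x. c * blinfun_apply f x)) = Blinfun (\<lambda>x. c * blinfun_apply (adj2 act b'' f) x)"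
    if f: "f \<in> dual scaleB" for f c
  proof (rule blinfun_eqI)
    fix a
    have "adj1 act (Blinfun (\<lambda>x. c * blinfun_apply f x)) a = Blinfun (\<lambda>b. c * blinfun_apply (adj1 act f a) b)"
      by (rule blinfun_eqI) (unfold scale_dual_apply, simp add: adj1_apply scale_dual_apply)
    then show "blinfun_apply (adj2 act b'' (Blinfun (\<lambda>x. c * blinfun_apply f x))) a
        = blinfun_apply (Blinfun (\<lambda>x. c * blinfun_apply (adj2 act b'' f) x)) a"
      using b'' f adj1_in_dual[OF f]
      by (unfold scale_dual_apply, simp add: adj2_apply dsc) (simp add: bidual_def)
  qed
  have nb: "norm (adj2 act b'' f) \<le> \<bar>M\<bar> * L * norm f" if f: "f \<in> dual scaleB" for f
  proof (rule norm_blinfun_bound)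
    show "0 \<le> \<bar>M\<bar> * L * norm f" using \<open>L \<ge> 0\<close> by simp
    show "norm (blinfun_apply (adj2 act b'' f) a) \<le> \<bar>M\<bar> * L * norm f * norm a" for a
    proof -
      have n1: "norm (adj1 act f a) \<le> norm f * norm a * L"
      proof (rule norm_blinfun_bound)
        show "0 \<le> norm f * norm a * L" using \<open>L \<ge> 0\<close> by simp
        show "norm (blinfun_apply (adj1 act f a) b) \<le> norm f * norm a * L * norm b" for b
        proof -
          have "norm (blinfun_apply f (act a b)) \<le> norm f * norm (act a b)" by (rule norm_blinfun)
          also have "\<dots> \<le> norm f * (norm a * norm b * L)" by (intro mult_left_mono L) auto
          finally show ?thesis by (simp add: adj1_apply mult_ac)
        qed
      qed
      have "norm (b'' (adj1 act f a)) \<le> M * norm (adj1 act f a)" by (rule M[OF adj1_in_dual[OF f]])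
      also have "\<dots> \<le> \<bar>M\<bar> * (norm f * norm a * L)" by (intro mult_mono n1) auto
      finally show ?thesis by (simp add: adj2_apply[OF b'' f] mult_ac)
    qed
  qed
  have "norm (adj3 scaleB act a'' b'' f) \<le> (\<bar>K\<bar> * (\<bar>M\<bar> * L)) * norm f" if f: "f \<in> dual scaleB" for f
  proof -
    have "norm (a'' (adj2 act b'' f)) \<le> K * norm (adj2 act b'' f)" by (rule K[OF adj2_in_dual[OF b'' f]])
    also have "\<dots> \<le> \<bar>K\<bar> * (\<bar>M\<bar> * L * norm f)" by (intro mult_mono nb f) auto
    finally show ?thesis using f by (simp add: adj3_def mult_ac)
  qed
  moreover have "adj3 scaleB act a'' b'' \<in> extensional (dual scaleB)"
    by (simp add: adj3_def)
  moreover have "adj3 scaleB act a'' b'' (f + g) = adj3 scaleB act a'' b'' f + adj3 scaleB act a'' b'' g"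
    if "f \<in> dual scaleB" "g \<in> dual scaleB" for f g
    using that a'' adj2_in_dual[OF b''] by (simp add: adj3_def dadd add) (simp add: bidual_def)
  moreover have "adj3 scaleB act a'' b'' (Blinfun (\<lambda>x. c * blinfun_apply f x)) = c * adj3 scaleB act a'' b'' f"
    if "f \<in> dual scaleB" for f c
    using that a'' adj2_in_dual[OF b''] by (simp add: adj3_def dsc sc) (simp add: bidual_def)
  ultimately show ?thesis unfolding bidual_def by blast
qed

end

lemma (in banach_algebra_over) left_banach_module_self: "left_banach_module scl scl (*)"
proof -
  interpret m: bounded_bilinear "(*) :: 'a \<Rightarrow> 'a \<Rightarrow> 'a" by (rule bounded_bilinear_mult)
  show ?thesis
    by unfold_locales (simp_all add: mult.assoc scale_mult_left scale_mult_right)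
qed

end

theory Submission
  imports Defs
begin

text \<open>
  Let \<open>e''\<close> be a left unit. If \<open>b''\<close> annihilates \<open>B\<^sup>*A\<close>, then \<open>\<pi>\<^sup>*\<^sup>*(b'', b')\<close> is the functional
  \<open>a \<mapsto> \<langle>b'', b'a\<rangle> = 0\<close> for every \<open>b'\<close>, so \<open>\<langle>b'', b'\<rangle> = \<langle>e'', \<pi>\<^sup>*\<^sup>*(b'', b')\<rangle> = 0\<close>. Thus the existence of
  a left unit forces \<open>(B\<^sup>*A)\<^sup>\<bottom> = 0\<close> (lemma \<open>annihilator_dual_times\<close>), which gives the first part.

  As \<open>e''\<close> acts on \<open>B\<^sup>*\<^sup>*\<close> as the identity, its action is weak* continuous, and the second part amounts
  to the following: a left unit can exist only when \<open>B\<^sup>*\<close> factors on the left. By the first part it is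
  enough to deduce \<open>B\<^sup>*A = B\<^sup>*\<close> from \<open>(B\<^sup>*A)\<^sup>\<bottom> = 0\<close>. The functionals \<open>f \<in> B\<^sup>*\<close> with
  \<open>f e\<^sub>i \<longlonglongrightarrow> f\<close> form a closed subspace that contains \<open>B\<^sup>*A\<close>, because \<open>(e\<^sub>i)\<close> is a bounded approximate
  identity. By Hahn--Banach this subspace is all of \<open>B\<^sup>*\<close> (\<open>dual_approximate_identity\<close>), so \<open>(e\<^sub>i)\<close> is
  an approximate identity for the right module \<open>B\<^sup>*\<close> as well, and Cohen's factorization theorem
  (\<open>cohen_factorization\<close>) writes every element of \<open>B\<^sup>*\<close> as a product \<open>b'a\<close>.

  Hahn--Banach is proved by finding a minimal sublinear functional below a given one. It yields a
  real functional, which is then turned into one over the scalar field.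
\<close>

section \<open>Hahn--Banach separation from a subspace\<close>

definition sublinear :: "('x::real_vector \<Rightarrow> real) \<Rightarrow> bool" where
  "sublinear p \<longleftrightarrow> (\<forall>x y. p (x + y) \<le> p x + p y) \<and> (\<forall>c\<ge>0. \<forall>x. p (c *\<^sub>R x) \<le> c * p x)"

lemma sublinear_add: "sublinear p \<Longrightarrow> p (x + y) \<le> p x + p y"
  by (simp add: sublinear_def)

lemma sublinear_scale_le: "sublinear p \<Longrightarrow> c \<ge> 0 \<Longrightarrow> p (c *\<^sub>R x) \<le> c * p x"
  by (simp add: sublinear_def)

lemma sublinear_zero: assumes "sublinear p" shows "p 0 = 0"
  using sublinear_add[OF assms, of 0 0] sublinear_scale_le[OF assms, of 0 0] by simp

lemma sublinear_scale:
  assumes p: "sublinear p" and c: "c \<ge> 0"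
  shows "p (c *\<^sub>R x) = c * p x"
proof (cases "c = 0")
  case True
  then show ?thesis using sublinear_zero[OF p] by simp
next
  case False
  then have "p x \<le> inverse c * p (c *\<^sub>R x)"
    using sublinear_scale_le[OF p, of "inverse c" "c *\<^sub>R x"] c by simp
  then have "c * p x \<le> p (c *\<^sub>R x)"
    using False c by (simp add: field_simps)
  then show ?thesis using sublinear_scale_le[OF p c, of x] by simp
qed

lemma sublinear_neg: assumes "sublinear p" shows "- p (- x) \<le> p x"
  using sublinear_add[OF assms, of x "- x"] sublinear_zero[OF assms] by simp

text \<open>This is the largest sublinear functional below \<open>q\<close> whose value at \<open>- y\<close> is at most \<open>- q y\<close>. It serves
  two purposes: a minimal \<open>q\<close> must agree with it, which makes \<open>q\<close> odd; and it forces a linear functional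
  below it to take at \<open>y\<close> a value no smaller than \<open>q y\<close>.\<close>

definition descend :: "('x::real_vector \<Rightarrow> real) \<Rightarrow> 'x \<Rightarrow> 'x \<Rightarrow> real" where
  "descend q y x = (INF t\<in>{0..}. q (x + t *\<^sub>R y) - t * q y)"

lemma descend_bdd_below:
  assumes "sublinear q" shows "bdd_below ((\<lambda>t. q (x + t *\<^sub>R y) - t * q y) ` {0..})"
proof (rule bdd_belowI2)
  fix t :: real assume "t \<in> {0..}"
  then show "- q (- x) \<le> q (x + t *\<^sub>R y) - t * q y"
    using sublinear_add[OF assms, of "x + t *\<^sub>R y" "- x"] sublinear_scale[OF assms, of t y] by simp
qed

lemma descend_le:
  assumes "sublinear q" "t \<ge> 0" shows "descend q y x \<le> q (x + t *\<^sub>R y) - t * q y"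
  unfolding descend_def by (rule cINF_lower[OF descend_bdd_below[OF assms(1)]]) (use assms in auto)

lemma descend_greatest:
  assumes "\<And>t. t \<ge> 0 \<Longrightarrow> m \<le> q (x + t *\<^sub>R y) - t * q y" shows "m \<le> descend q y x"
  unfolding descend_def by (rule cINF_greatest) (use assms in auto)

lemma descend_le_self: "sublinear q \<Longrightarrow> descend q y x \<le> q x"
  using descend_le[of q 0 y x] by simp

lemma descend_neg: "sublinear q \<Longrightarrow> descend q y (- y) \<le> - q y"
  using descend_le[of q 1 y "- y"] by (simp add: sublinear_zero)

lemma sublinear_descend:
  assumes q: "sublinear q" shows "sublinear (descend q y)"
  unfolding sublinear_def
proof (intro conjI allI impI)
  fix a b
  have "descend q y (a + b) - (q (a + s *\<^sub>R y) - s * q y) \<le> q (b + t *\<^sub>R y) - t * q y"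
    if "s \<ge> 0" "t \<ge> 0" for s t
    using descend_le[OF q, of "s + t" y "a + b"] that sublinear_add[OF q, of "a + s *\<^sub>R y" "b + t *\<^sub>R y"]
    by (simp add: algebra_simps)
  then have "descend q y (a + b) - (q (a + s *\<^sub>R y) - s * q y) \<le> descend q y b" if "s \<ge> 0" for s
    using that by (intro descend_greatest) auto
  then have "descend q y (a + b) - descend q y b \<le> descend q y a"
    by (intro descend_greatest) (simp add: algebra_simps)
  then show "descend q y (a + b) \<le> descend q y a + descend q y b" by simp
next
  fix c :: real and x
  assume c: "c \<ge> 0"
  show "descend q y (c *\<^sub>R x) \<le> c * descend q y x"
  proof (cases "c = 0")
    case True
    then show ?thesis using descend_le_self[OF q, of y 0] sublinear_zero[OF q] by simp
  next
    case False
    then have c: "c > 0" using c by simp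
    have "descend q y (c *\<^sub>R x) / c \<le> q (x + s *\<^sub>R y) - s * q y" if "s \<ge> 0" for s
    proof -
      have "descend q y (c *\<^sub>R x) \<le> q (c *\<^sub>R (x + s *\<^sub>R y)) - (c * s) * q y"
        using descend_le[OF q, of "c * s" y "c *\<^sub>R x"] c that by (simp add: algebra_simps)
      also have "\<dots> = c * (q (x + s *\<^sub>R y) - s * q y)"
        using sublinear_scale[OF q, of c "x + s *\<^sub>R y"] c by (simp add: scaleR_add_right right_diff_distrib)
      finally show ?thesis using c by (simp add: field_simps)
    qed
    then have "descend q y (c *\<^sub>R x) / c \<le> descend q y x" by (rule descend_greatest)
    then show ?thesis using c by (simp add: field_simps)
  qed
qed

text \<open>Minimality gives \<open>q (- y) = - q y\<close> by comparison with \<^const>\<open>descend\<close>, and a sublinear functional that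
  is odd is linear.\<close>

lemma minimal_sublinear_linear:
  assumes q: "sublinear q" and min: "\<And>r. sublinear r \<Longrightarrow> r \<le> q \<Longrightarrow> r = q"
  shows "linear q"
proof -
  have neg: "q (- y) = - q y" for y
  proof -
    have "descend q y = q"
      by (intro min sublinear_descend q le_funI descend_le_self)
    then show ?thesis
      using descend_neg[OF q, of y] sublinear_neg[OF q, of "- y"] by simp
  qed
  show ?thesis
  proof (rule linearI)
    fix x y
    show "q (x + y) = q x + q y"
      using sublinear_add[OF q, of x y] sublinear_add[OF q, of "x + y" "- y"] neg[of y] by simp
  next
    fix c :: real and x
    show "q (c *\<^sub>R x) = c *\<^sub>R q x"
    proof (cases "c \<ge> 0")
      case True
      then show ?thesis using sublinear_scale[OF q] by simp
    next
      case False
      then show ?thesis using sublinear_scale[OF q, of "- c" x] neg[of "c *\<^sub>R x"] by simp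
    qed
  qed
qed

text \<open>Zorn's lemma on the sublinear functionals below \<open>p\<close>. A chain has its pointwise infimum as a lower
  bound: \<open>- p (- x)\<close> bounds the values at \<open>x\<close> from below, and subadditivity survives because any two
  members of the chain have a smaller one.\<close>

lemma ex_linear_below_sublinear:
  fixes p :: "'x::real_vector \<Rightarrow> real"
  assumes p: "sublinear p"
  shows "\<exists>q. linear q \<and> q \<le> p"
proof -
  define A where "A = {q. sublinear q \<and> q \<le> p}"
  have "\<exists>m\<in>A. \<forall>a\<in>A. m \<ge> a \<longrightarrow> a = m"
  proof (rule predicate_Zorn)
    show "partial_order_on A (relation_of (\<ge>) A)"
      by (rule partial_order_on_relation_ofI) auto
    fix C assume C: "C \<in> Chains (relation_of (\<ge>) A)"
    have CA: "C \<subseteq> A" using C by (auto simp: Chains_def relation_of_def)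
    have chain: "f \<le> g \<or> g \<le> f" if "f \<in> C" "g \<in> C" for f g
      using C that by (auto simp: Chains_def relation_of_def)
    show "\<exists>u\<in>A. \<forall>a\<in>C. a \<ge> u"
    proof (cases "C = {}")
      case True
      then show ?thesis using p by (auto simp: A_def)
    next
      case False
      have sub: "sublinear f" and lep: "f x \<le> p x" if "f \<in> C" for f x
        using that CA by (auto simp: A_def le_fun_def)
      define u where "u = (\<lambda>x. INF f\<in>C. f x)"
      have bdd: "bdd_below ((\<lambda>f. f x) ` C)" for x
      proof (rule bdd_belowI2)
        fix f assume f: "f \<in> C"
        show "- p (- x) \<le> f x" using sublinear_neg[OF sub[OF f], of x] lep[OF f, of "- x"] by simp
      qed
      have lower: "u x \<le> f x" if "f \<in> C" for f x
        unfolding u_def by (rule cINF_lower[OF bdd that])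
      have greatest: "m \<le> u x" if "\<And>f. f \<in> C \<Longrightarrow> m \<le> f x" for m x
        unfolding u_def by (rule cINF_greatest[OF False that])
      have "sublinear u" unfolding sublinear_def
      proof (intro conjI allI impI)
        fix x y
        have "u (x + y) - f x \<le> g y" if f: "f \<in> C" and g: "g \<in> C" for f g
        proof -
          obtain h where h: "h \<in> C" "h \<le> f" "h \<le> g" using chain[OF f g] f g by auto
          have "u (x + y) \<le> h x + h y"
            using lower[OF h(1), of "x + y"] sublinear_add[OF sub[OF h(1)], of x y] by simp
          also have "\<dots> \<le> f x + g y" using h by (auto simp: le_fun_def intro: add_mono)
          finally show ?thesis by simp
        qed
        then have "u (x + y) - f x \<le> u y" if "f \<in> C" for f using greatest that by blast
        then have "u (x + y) - u y \<le> u x" by (intro greatest) (simp add: algebra_simps)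
        then show "u (x + y) \<le> u x + u y" by simp
      next
        fix c :: real and x assume c: "c \<ge> 0"
        have *: "u (c *\<^sub>R x) \<le> c * f x" if "f \<in> C" for f
          using lower[OF that] sublinear_scale_le[OF sub[OF that] c] order_trans by blast
        show "u (c *\<^sub>R x) \<le> c * u x"
        proof (cases "c = 0")
          case True
          then show ?thesis using * False by auto
        next
          case c0: False
          then have "u (c *\<^sub>R x) / c \<le> u x" using * c by (intro greatest) (simp add: field_simps)
          then show ?thesis using c c0 by (simp add: field_simps)
        qed
      qed
      moreover have "u \<le> p"
      proof (rule le_funI)
        fix x
        obtain f where "f \<in> C" using False by blast
        then show "u x \<le> p x" using lower[of f x] lep[of f x] by simp
      qed
      ultimately show ?thesis using lower by (auto simp: A_def le_fun_def)
    qed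
  qed
  then obtain q where q: "sublinear q" "q \<le> p" "\<And>r. sublinear r \<Longrightarrow> r \<le> p \<Longrightarrow> r \<le> q \<Longrightarrow> r = q"
    by (auto simp: A_def)
  have "linear q"
    by (rule minimal_sublinear_linear[OF q(1)]) (blast intro: q(3) order_trans[OF _ q(2)])
  then show ?thesis using q by blast
qed

lemma sublinear_infdist:
  fixes S :: "'x::real_normed_vector set"
  assumes S: "subspace S"
  shows "sublinear (\<lambda>x. infdist x S)"
proof -
  have ne: "S \<noteq> {}" using subspace_0[OF S] by auto
  have le: "infdist x S \<le> norm (x - s)" if "s \<in> S" for x s
    using infdist_le[OF that, of x] by (simp add: dist_norm)
  have ge: "m \<le> infdist x S" if "\<And>s. s \<in> S \<Longrightarrow> m \<le> norm (x - s)" for m x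
    unfolding infdist_notempty[OF ne] by (rule cINF_greatest[OF ne]) (use that in \<open>auto simp: dist_norm\<close>)
  show ?thesis unfolding sublinear_def
  proof (intro conjI allI impI)
    fix x y
    have "infdist (x + y) S - norm (x - s) \<le> norm (y - t)" if "s \<in> S" "t \<in> S" for s t
      using le[of "s + t" "x + y"] subspace_add[OF S that] norm_triangle_ineq[of "x - s" "y - t"]
      by (simp add: algebra_simps)
    then have "infdist (x + y) S - norm (x - s) \<le> infdist y S" if "s \<in> S" for s
      using that ge by blast
    then have "infdist (x + y) S - infdist y S \<le> infdist x S"
      by (intro ge) (simp add: algebra_simps)
    then show "infdist (x + y) S \<le> infdist x S + infdist y S" by simp
  next
    fix c :: real and x assume c: "c \<ge> 0"
    have *: "infdist (c *\<^sub>R x) S \<le> c * norm (x - s)" if "s \<in> S" for s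
    proof -
      have "infdist (c *\<^sub>R x) S \<le> norm (c *\<^sub>R (x - s))"
        using le[OF subspace_scale[OF S that, of c]] by (simp add: scaleR_diff_right)
      then show ?thesis using c by simp
    qed
    show "infdist (c *\<^sub>R x) S \<le> c * infdist x S"
    proof (cases "c = 0")
      case True
      then show ?thesis using *[OF subspace_0[OF S]] by simp
    next
      case False
      then have "infdist (c *\<^sub>R x) S / c \<le> infdist x S"
        using * c by (intro ge) (simp add: field_simps)
      then show ?thesis using False c by (simp add: field_simps)
    qed
  qed
qed

text \<open>The distance to \<open>S\<close> is the quotient seminorm modulo \<open>S\<close>. A linear functional below it is bounded and
  vanishes on \<open>S\<close>; passing first to \<^const>\<open>descend\<close> in direction \<open>x0\<close> keeps its value at \<open>x0\<close> at least as
  large as the distance of \<open>x0\<close> from \<open>S\<close>.\<close>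

lemma ex_functional_separating:
  fixes S :: "'x::real_normed_vector set"
  assumes S: "subspace S" and x0: "x0 \<notin> closure S"
  shows "\<exists>u::'x \<Rightarrow> real. bounded_linear u \<and> (\<forall>s\<in>S. u s = 0) \<and> u x0 \<noteq> 0"
proof -
  define p where "p = (\<lambda>x. infdist x S)"
  have p: "sublinear p" unfolding p_def by (rule sublinear_infdist[OF S])
  have ne: "S \<noteq> {}" using subspace_0[OF S] by auto
  obtain u where u: "linear u" "u \<le> descend p x0"
    using ex_linear_below_sublinear[OF sublinear_descend[OF p]] by blast
  interpret u: linear u by (rule u(1))
  have le: "u x \<le> p x" for x
    using le_funD[OF u(2), of x] descend_le_self[OF p, of x0 x] by simp
  have pn: "p x \<le> norm x" for x
    using infdist_le[OF subspace_0[OF S], of x] by (simp add: p_def)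
  have ub: "norm (u x) \<le> norm x * 1" for x
    using le[of x] le[of "- x"] pn[of x] pn[of "- x"] by (simp add: u.neg)
  have "bounded_linear u"
    by (rule bounded_linear_intro[OF u.add u.scale ub])
  moreover have "u s = 0" if "s \<in> S" for s
    using le[of s] le[of "- s"] that subspace_neg[OF S that] by (simp add: p_def u.neg)
  moreover have "u x0 \<noteq> 0"
  proof -
    have "p x0 > 0"
      using x0 ne infdist_nonneg[of x0 S] in_closure_iff_infdist_zero[OF ne, of x0]
      unfolding p_def by linarith
    moreover have "u (- x0) \<le> - p x0"
      using le_funD[OF u(2), of "- x0"] descend_neg[OF p, of x0] by simp
    ultimately show ?thesis by (simp add: u.neg)
  qed
  ultimately show ?thesis by blast
qed

section \<open>Functionals over the scalar field\<close>

definition smul :: "'k::real_normed_field \<Rightarrow> ('x::real_normed_vector \<Rightarrow>\<^sub>L 'k) \<Rightarrow> ('x \<Rightarrow>\<^sub>L 'k)" where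
  "smul c f = Blinfun (\<lambda>x. c * blinfun_apply f x)"

lemma smul_apply:
  fixes f :: "'x::real_normed_vector \<Rightarrow>\<^sub>L 'k::real_normed_field"
  shows "blinfun_apply (smul c f) x = c * blinfun_apply f x"
  unfolding smul_def
  by (subst bounded_linear_Blinfun_apply)
    (auto intro: bounded_linear_const_mult blinfun.bounded_linear_right)

lemma norm_smul_le: "norm (smul c f) \<le> norm c * norm f"
proof (rule norm_blinfun_bound)
  fix x
  show "norm (blinfun_apply (smul c f) x) \<le> norm c * norm f * norm x"
    unfolding smul_apply norm_mult mult.assoc by (intro mult_left_mono norm_blinfun) auto
qed simp

lemma bounded_bilinear_smul:
  "bounded_bilinear (smul :: 'k::real_normed_field \<Rightarrow> ('x::real_normed_vector \<Rightarrow>\<^sub>L 'k) \<Rightarrow> _)"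
proof
  show "smul (a + a') b = smul a b + smul a' b" for a a' :: 'k and b :: "'x \<Rightarrow>\<^sub>L 'k"
    by (rule blinfun_eqI) (simp add: smul_apply plus_blinfun.rep_eq algebra_simps)
  show "smul a (b + b') = smul a b + smul a b'" for a :: 'k and b b' :: "'x \<Rightarrow>\<^sub>L 'k"
    by (rule blinfun_eqI) (simp add: smul_apply plus_blinfun.rep_eq algebra_simps)
  show "smul (r *\<^sub>R a) b = r *\<^sub>R smul a b" for r and a :: 'k and b :: "'x \<Rightarrow>\<^sub>L 'k"
    by (rule blinfun_eqI) (simp add: smul_apply scaleR_blinfun.rep_eq)
  show "smul a (r *\<^sub>R b) = r *\<^sub>R smul a b" for r and a :: 'k and b :: "'x \<Rightarrow>\<^sub>L 'k"
    by (rule blinfun_eqI) (simp add: smul_apply scaleR_blinfun.rep_eq)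
  show "\<exists>K. \<forall>a b. norm (smul a b :: 'x \<Rightarrow>\<^sub>L 'k) \<le> norm a * norm b * K"
    by (rule exI[of _ 1]) (simp add: norm_smul_le)
qed

lemma smul_smul: "smul c (smul d f) = smul (c * d) f"
  by (rule blinfun_eqI) (simp add: smul_apply)

lemma one_smul: "smul 1 f = f"
  by (rule blinfun_eqI) (simp add: smul_apply)

text \<open>Over the complex numbers one passes from a real functional \<open>u\<close> to \<open>u(x) - \<i> u(\<i>x)\<close>. The following
  works for all scalar fields considered at once. The real bilinear form \<open>(c, z) \<mapsto> (c z) \<bullet> 1\<close> on the
  field is nondegenerate, hence, by finite dimension, every real functional on the field is
  \<open>c \<mapsto> (c z) \<bullet> 1\<close> for exactly one \<open>z\<close>. The value of the new functional at \<open>x\<close> is the \<open>z\<close> that belongs to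
  \<open>c \<mapsto> u (c x)\<close>; uniqueness of \<open>z\<close> makes it linear over the field.\<close>

lemma ex_scalar_functional_separating:
  fixes S :: "('x::real_normed_vector \<Rightarrow>\<^sub>L 'k::{real_normed_field,euclidean_space}) set"
  assumes S: "subspace S" and S_smul: "\<And>c s. s \<in> S \<Longrightarrow> smul c s \<in> S" and x0: "x0 \<notin> closure S"
  shows "\<exists>\<phi>. bounded_linear \<phi> \<and> (\<forall>c x. \<phi> (smul c x) = c * \<phi> x) \<and> (\<forall>s\<in>S. \<phi> s = 0) \<and> \<phi> x0 \<noteq> 0"
proof -
  obtain u :: "('x \<Rightarrow>\<^sub>L 'k) \<Rightarrow> real" where u: "bounded_linear u" "\<And>s. s \<in> S \<Longrightarrow> u s = 0" "u x0 \<noteq> 0"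
    using ex_functional_separating[OF S x0] by blast
  interpret u: bounded_linear u by (rule u(1))
  interpret sm: bounded_bilinear "smul :: 'k \<Rightarrow> ('x \<Rightarrow>\<^sub>L 'k) \<Rightarrow> ('x \<Rightarrow>\<^sub>L 'k)"
    by (rule bounded_bilinear_smul)
  have riesz: "c \<bullet> (\<Sum>b\<in>Basis. v b *\<^sub>R b) = v c" if "linear v" for v :: "'k \<Rightarrow> real" and c
  proof -
    interpret v: linear v by (rule that)
    have "v c = v (\<Sum>b\<in>Basis. (c \<bullet> b) *\<^sub>R b)" by (simp add: euclidean_representation)
    also have "\<dots> = (\<Sum>b\<in>Basis. (c \<bullet> b) * v b)" by (simp add: v.sum v.scale)
    finally show ?thesis by (simp add: inner_sum_right mult.commute)
  qed
  \<comment> \<open>\<open>\<Phi> z\<close> represents the functional \<open>c \<mapsto> (c z) \<bullet> 1\<close> by the inner product, and \<open>W x\<close> below represents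
    \<open>c \<mapsto> u (c x)\<close>.\<close>
  define \<Phi> :: "'k \<Rightarrow> 'k" where "\<Phi> z = (\<Sum>b\<in>Basis. ((b * z) \<bullet> 1) *\<^sub>R b)" for z
  have \<Phi>: "c \<bullet> \<Phi> z = (c * z) \<bullet> 1" for c z
    unfolding \<Phi>_def
    by (rule riesz) (rule linearI, simp_all add: distrib_right inner_add_left)
  have lin\<Phi>: "linear \<Phi>"
    by (rule linearI; rule vector_eq_ldot[THEN iffD1])
      (simp_all add: \<Phi> inner_add_right inner_add_left distrib_left)
  interpret P: linear \<Phi> by (rule lin\<Phi>)
  have "inj \<Phi>"
    unfolding P.inj_iff_eq_0
  proof (intro allI impI)
    fix z assume "\<Phi> z = 0"
    then have "(inverse z * z) \<bullet> 1 = 0" using \<Phi>[of "inverse z" z] by simp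
    then show "z = 0" by (cases "z = 0") auto
  qed
  then have "surj \<Phi>" using linear_injective_imp_surjective[OF lin\<Phi>] by simp
  then have \<Phi>_inv: "\<Phi> (inv \<Phi> w) = w" for w by (simp add: surj_f_inv_f)
  have inv_eq: "inv \<Phi> w = z" if "\<Phi> z = w" for z w
    using that \<open>inj \<Phi>\<close> by (metis inv_f_f)
  have lin_inv: "linear (inv \<Phi>)"
    by (rule linearI; rule inv_eq) (simp_all add: P.add P.scale \<Phi>_inv)
  define W where "W x = (\<Sum>b\<in>Basis. u (smul b x) *\<^sub>R b)" for x
  have W: "c \<bullet> W x = u (smul c x)" for c x
    unfolding W_def
    by (rule riesz) (rule linearI, simp_all only: sm.add_left sm.scaleR_left u.add u.scaleR)
  have W_lin: "bounded_linear W"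
    unfolding W_def
    by (intro bounded_linear_sum bounded_linear_scaleR_const bounded_linear_compose[OF u(1)] sm.bounded_linear_right)
  define \<phi> where "\<phi> x = inv \<Phi> (W x)" for x
  have "bounded_linear \<phi>"
    unfolding \<phi>_def using lin_inv W_lin
    by (intro bounded_linear_compose[of "inv \<Phi>" W]) (simp add: linear_conv_bounded_linear)
  moreover have "\<phi> (smul c x) = c * \<phi> x" for c x
    unfolding \<phi>_def
  proof (rule inv_eq, rule vector_eq_ldot[THEN iffD1], rule allI)
    fix d
    have "d \<bullet> \<Phi> (c * inv \<Phi> (W x)) = (d * c) \<bullet> \<Phi> (inv \<Phi> (W x))"
      by (simp add: \<Phi> mult.assoc)
    then show "d \<bullet> \<Phi> (c * inv \<Phi> (W x)) = d \<bullet> W (smul c x)"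
      by (simp only: \<Phi>_inv W smul_smul)
  qed
  moreover have "\<phi> s = 0" if "s \<in> S" for s
  proof -
    have "W s = 0" unfolding W_def using u(2)[OF S_smul[OF that]] by simp
    then show ?thesis unfolding \<phi>_def by (intro inv_eq) (simp add: P.zero)
  qed
  moreover have "\<phi> x0 \<noteq> 0"
  proof
    assume "\<phi> x0 = 0"
    then have "W x0 = 0" using \<Phi>_inv[of "W x0"] by (simp add: \<phi>_def P.zero)
    then have "u (smul 1 x0) = 0" using W[of 1 x0] by simp
    then show False using u(3) by (simp only: one_smul)
  qed
  ultimately show ?thesis by blast
qed


section \<open>Cohen factorization\<close>

text \<open>To solve \<open>S y = z\<close>, iterate \<open>y \<mapsto> T\<^sup>-\<^sup>1(z - (S - T) y)\<close>, a contraction with constant \<open>\<epsilon> / \<delta>\<close>. The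
  solution stays in the complete subspace \<open>X\<close>.\<close>

lemma bijective_perturbation:
  fixes T S :: "'x::real_normed_vector \<Rightarrow> 'x"
  assumes X: "complete X" "subspace X"
    and T: "linear T" "T ` X = X" "\<And>y. y \<in> X \<Longrightarrow> \<delta> * norm y \<le> norm (T y)"
    and S: "linear S" "S ` X \<subseteq> X" "\<And>y. y \<in> X \<Longrightarrow> norm (S y - T y) \<le> \<epsilon> * norm y"
    and \<epsilon>: "0 \<le> \<epsilon>" "\<epsilon> < \<delta>"
  shows "S ` X = X" and "\<And>y. y \<in> X \<Longrightarrow> (\<delta> - \<epsilon>) * norm y \<le> norm (S y)"
proof -
  interpret T: linear T by fact
  interpret S: linear S by fact
  have TX: "T y \<in> X" if "y \<in> X" for y using T(2) that by blast
  have SX: "S y \<in> X" if "y \<in> X" for y using S(2) that by blast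
  show "(\<delta> - \<epsilon>) * norm y \<le> norm (S y)" if "y \<in> X" for y
    using T(3)[OF that] S(3)[OF that] norm_triangle_ineq3[of "S y" "T y"] by (simp add: algebra_simps)
  have "\<exists>y\<in>X. S y = z" if z: "z \<in> X" for z
  proof -
    define G where "G w = (SOME y. y \<in> X \<and> T y = w)" for w
    have G: "G w \<in> X \<and> T (G w) = w" if "w \<in> X" for w
      unfolding G_def by (rule someI_ex) (use T(2)[THEN equalityD2, THEN subsetD, OF that] in blast)
    define f where "f y = G (z - (S y - T y))" for y
    have in_X: "z - (S y - T y) \<in> X" if "y \<in> X" for y
      by (intro subspace_diff[OF X(2)] z TX SX that)
    have Tf: "T (f y) = z - (S y - T y)" and fX: "f y \<in> X" if "y \<in> X" for y
      using G[OF in_X[OF that]] by (auto simp: f_def)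
    have "\<exists>!y\<in>X. f y = y"
    proof (rule Banach_fix)
      show "complete X" "X \<noteq> {}" "f ` X \<subseteq> X" using X z fX by auto
      show "0 \<le> \<epsilon> / \<delta>" "\<epsilon> / \<delta> < 1" using \<epsilon> by auto
      fix x y assume xy: "x \<in> X" "y \<in> X"
      have "\<delta> * norm (f x - f y) \<le> norm (T (f x - f y))"
        using xy by (intro T(3) subspace_diff[OF X(2)] fX)
      also have "T (f x - f y) = - (S (x - y) - T (x - y))"
        using xy by (simp add: T.diff S.diff Tf)
      also have "norm \<dots> \<le> \<epsilon> * norm (x - y)"
        unfolding norm_minus_cancel by (intro S(3) subspace_diff[OF X(2)] xy)
      finally show "dist (f x) (f y) \<le> \<epsilon> / \<delta> * dist x y"
        using \<epsilon> by (simp add: dist_norm field_simps)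
    qed
    then obtain y where y: "y \<in> X" "f y = y" by blast
    then show ?thesis using Tf[OF y(1)] by auto
  qed
  then show "S ` X = X" using S(2) by auto
qed

text \<open>The module is a complete subspace of a Banach space on which the algebra acts, since the dual space
  to which this is applied is a subset of its type.\<close>

locale right_action = bounded_bilinear act
  for act :: "'x::banach \<Rightarrow> 'a::{real_normed_algebra,banach} \<Rightarrow> 'x" +
  fixes X :: "'x set"
  assumes act_assoc: "act (act x a) b = act x (a * b)"
    and X_complete: "complete X"
    and X_subspace: "subspace X"
    and X_act: "x \<in> X \<Longrightarrow> act x a \<in> X"
begin

text \<open>The action of the element \<open>l + a\<close> of the unitization of the algebra. Invertibility in the
  unitization is replaced by bijectivity of this operator on \<open>X\<close> together with a bound on the inverse,
  so that the unitization itself need not be constructed.\<close>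

definition unitized :: "real \<Rightarrow> 'a \<Rightarrow> 'x \<Rightarrow> 'x" where
  "unitized l a y = l *\<^sub>R y + act y a"

definition invertible_by :: "real \<Rightarrow> real \<Rightarrow> 'a \<Rightarrow> bool" where
  "invertible_by \<delta> l a \<longleftrightarrow> unitized l a ` X = X \<and> (\<forall>y\<in>X. \<delta> * norm y \<le> norm (unitized l a y))"

lemma linear_unitized: "linear (unitized l a)"
  by (rule linearI) (simp_all add: unitized_def add_left scaleR_left scaleR_add_right)

lemma unitized_in: "y \<in> X \<Longrightarrow> unitized l a y \<in> X"
  by (simp add: unitized_def subspace_add[OF X_subspace] subspace_scale[OF X_subspace] X_act)

lemma invertible_by_perturb:
  assumes "invertible_by \<delta> l a" "0 \<le> \<epsilon>" "\<epsilon> < \<delta>"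
    and "\<And>y. y \<in> X \<Longrightarrow> norm (unitized m b y - unitized l a y) \<le> \<epsilon> * norm y"
  shows "invertible_by (\<delta> - \<epsilon>) m b"
  using bijective_perturbation[OF X_complete X_subspace linear_unitized _ _ linear_unitized _ _ assms(2,3),
      of l a m b] assms unitized_in
  by (auto simp: invertible_by_def image_subset_iff)

lemma invertible_by_near_unit:
  assumes L: "\<And>y a. norm (act y a) \<le> norm y * norm a * L" "L \<ge> 0"
    and e: "norm e \<le> M" and g: "0 \<le> g" "g * (1 + M * L) \<le> 1 / 2"
  shows "invertible_by (1 / 2) (1 - g) (g *\<^sub>R e)"
proof -
  have "unitized 1 0 y = y" for y by (simp add: unitized_def zero_right)
  then have "invertible_by 1 1 0" by (simp add: invertible_by_def)
  then have "invertible_by (1 - 1 / 2) (1 - g) (g *\<^sub>R e)"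
  proof (rule invertible_by_perturb)
    fix y
    have "norm (unitized (1 - g) (g *\<^sub>R e) y - unitized 1 0 y) = norm (g *\<^sub>R (act y e - y))"
      by (simp add: unitized_def zero_right scaleR_right algebra_simps)
    also have "\<dots> \<le> g * (norm y * M * L + norm y)"
    proof -
      have "norm (act y e) \<le> norm y * M * L"
        by (rule order_trans[OF L(1)]) (intro mult_right_mono mult_left_mono e L(2) norm_ge_zero)
      then show ?thesis
        using g(1) norm_triangle_ineq4[of "act y e" y] by (simp add: mult_left_mono)
    qed
    also have "\<dots> = g * (1 + M * L) * norm y" by (simp add: algebra_simps)
    also have "\<dots> \<le> 1 / 2 * norm y" by (intro mult_right_mono g) auto
    finally show "norm (unitized (1 - g) (g *\<^sub>R e) y - unitized 1 0 y) \<le> 1 / 2 * norm y" .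
  qed auto
  then show ?thesis by simp
qed

text \<open>With \<open>E = (1 - g) + g e\<close>, the element \<open>w = x E\<^sup>-\<^sup>1\<close> satisfies \<open>(w - x) E = - g (x e - x)\<close>, so it is as
  close to \<open>x\<close> as \<open>x e\<close> is.\<close>

lemma near_unit_preimage:
  assumes inv: "invertible_by (1 / 2) (1 - g) (g *\<^sub>R e)" and g: "0 \<le> g" and x: "x \<in> X"
  shows "\<exists>w\<in>X. unitized (1 - g) (g *\<^sub>R e) w = x \<and> norm (w - x) \<le> 2 * g * norm (act x e - x)"
proof -
  interpret U: linear "unitized (1 - g) (g *\<^sub>R e)" by (rule linear_unitized)
  obtain w where w: "w \<in> X" "unitized (1 - g) (g *\<^sub>R e) w = x"
    using inv x unfolding invertible_by_def by (metis imageE)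
  have "unitized (1 - g) (g *\<^sub>R e) (w - x) = - (g *\<^sub>R (act x e - x))"
    unfolding U.diff w(2) by (simp add: unitized_def scaleR_right algebra_simps)
  moreover have "1 / 2 * norm (w - x) \<le> norm (unitized (1 - g) (g *\<^sub>R e) (w - x))"
    using inv subspace_diff[OF X_subspace w(1) x] unfolding invertible_by_def by blast
  ultimately have "norm (w - x) \<le> 2 * g * norm (act x e - x)" using g by simp
  then show ?thesis using w by blast
qed

end

lemma right_action_mult: "right_action ((*) :: 'a::{real_normed_algebra,banach} \<Rightarrow> _) UNIV"
  by (intro right_action.intro right_action_axioms.intro bounded_bilinear_mult)
    (auto simp: mult.assoc complete_UNIV)

context right_action
begin

text \<open>Write \<open>b = l + a\<close> and \<open>E = (1 - g) + g e\<^sub>i\<close>. The new element is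
  \<open>b' = a + l E = (l + d) E\<close> with \<open>d = a E\<^sup>-\<^sup>1\<close>. If \<open>e\<^sub>i\<close> nearly fixes \<open>a\<close> and \<open>x\<close>, then \<open>d\<close> is close to \<open>a\<close> and
  \<open>w = x E\<^sup>-\<^sup>1\<close> is close to \<open>x\<close>; hence \<open>l + d\<close> is still invertible, and \<open>y' = x b'\<^sup>-\<^sup>1 = w (l + d)\<^sup>-\<^sup>1\<close> is
  close to \<open>y = x b\<^sup>-\<^sup>1\<close>.\<close>

lemma cohen_step:
  assumes L: "\<And>y a. norm (act y a) \<le> norm y * norm a * L" "L \<ge> 0"
    and e: "\<And>i. norm (e i) \<le> M" and F: "F \<noteq> bot"
    and ax: "\<And>a. ((\<lambda>i. a * e i) \<longlongrightarrow> a) F" and xx: "((\<lambda>i. act x (e i)) \<longlongrightarrow> x) F" and x: "x \<in> X"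
    and g: "0 \<le> g" "g * (1 + M * L) \<le> 1 / 2" "g * (1 + M) \<le> 1 / 2"
    and inv: "invertible_by \<delta> l a" "\<delta> > 0" and y: "y \<in> X" "unitized l a y = x" and \<eta>: "\<eta> > 0"
  shows "\<exists>i. \<exists>\<delta>'>0. invertible_by \<delta>' ((1 - g) * l) (a + (g * l) *\<^sub>R e i) \<and>
           (\<exists>y'\<in>X. unitized ((1 - g) * l) (a + (g * l) *\<^sub>R e i) y' = x \<and> norm (y' - y) < \<eta>)"
proof -
  \<comment> \<open>The algebra acting on itself: this is where \<open>d = a E\<^sup>-\<^sup>1\<close> is found.\<close>
  interpret A: right_action "(*) :: 'a \<Rightarrow> 'a \<Rightarrow> 'a" UNIV by (rule right_action_mult)
  define \<epsilon> where "\<epsilon> i = 2 * g * norm (a * e i - a) * L" for i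
  define \<rho> where "\<rho> i = 2 * g * norm (act x (e i) - x)" for i
  have d0: "((\<lambda>i. norm (a * e i - a)) \<longlongrightarrow> 0) F" "((\<lambda>i. norm (act x (e i) - x)) \<longlongrightarrow> 0) F"
    using ax[of a] xx by (simp_all add: tendsto_norm_zero_iff LIM_zero_iff)
  have \<epsilon>: "(\<epsilon> \<longlongrightarrow> 0) F" and \<rho>: "(\<rho> \<longlongrightarrow> 0) F"
    unfolding \<epsilon>_def \<rho>_def using d0 by (auto intro!: tendsto_mult_left_zero tendsto_mult_right_zero)
  have "((\<lambda>i. 2 / \<delta> * (\<epsilon> i * norm y + \<rho> i)) \<longlongrightarrow> 2 / \<delta> * (0 * norm y + 0)) F"
    by (intro tendsto_intros \<epsilon> \<rho>)
  then have "\<forall>\<^sub>F i in F. 2 / \<delta> * (\<epsilon> i * norm y + \<rho> i) < \<eta>"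
    using \<eta> by (auto dest: order_tendstoD(2))
  moreover have "\<forall>\<^sub>F i in F. \<epsilon> i < \<delta> / 2"
    using order_tendstoD(2)[OF \<epsilon>, of "\<delta> / 2"] inv(2) by simp
  ultimately obtain i where i: "2 / \<delta> * (\<epsilon> i * norm y + \<rho> i) < \<eta>" "\<epsilon> i < \<delta> / 2"
    using eventually_happens'[OF F eventually_conj] by blast
  have \<epsilon>0: "0 \<le> \<epsilon> i" using g(1) L(2) by (simp add: \<epsilon>_def)
  have invE: "invertible_by (1 / 2) (1 - g) (g *\<^sub>R e i)"
    by (rule invertible_by_near_unit[OF L e g(1,2)])
  have invA: "A.invertible_by (1 / 2) (1 - g) (g *\<^sub>R e i)"
    by (rule A.invertible_by_near_unit[of 1, OF _ _ e g(1)]) (use g in \<open>auto simp: norm_mult_ineq\<close>)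
  obtain d where d: "A.unitized (1 - g) (g *\<^sub>R e i) d = a" "norm (d - a) \<le> 2 * g * norm (a * e i - a)"
    using A.near_unit_preimage[OF invA g(1), of a] by auto
  obtain w where w: "w \<in> X" "unitized (1 - g) (g *\<^sub>R e i) w = x" "norm (w - x) \<le> \<rho> i"
    using near_unit_preimage[OF invE g(1) x] unfolding \<rho>_def by blast
  have diff: "norm (unitized l d v - unitized l a v) \<le> \<epsilon> i * norm v" for v
  proof -
    have "norm (act v (d - a)) \<le> norm v * norm (d - a) * L" by (rule L(1))
    also have "\<dots> \<le> norm v * (2 * g * norm (a * e i - a)) * L"
      by (intro mult_right_mono mult_left_mono d(2) L(2) norm_ge_zero)
    finally show ?thesis by (simp add: unitized_def diff_right \<epsilon>_def mult_ac)
  qed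
  have invD: "invertible_by (\<delta> - \<epsilon> i) l d"
    by (rule invertible_by_perturb[OF inv(1) \<epsilon>0]) (use i inv(2) diff in auto)
  have comp: "unitized ((1 - g) * l) (a + (g * l) *\<^sub>R e i) v = unitized (1 - g) (g *\<^sub>R e i) (unitized l d v)" for v
    by (subst d(1)[symmetric])
      (simp add: unitized_def A.unitized_def add_left add_right diff_right scaleR_left scaleR_right act_assoc[symmetric]
        algebra_simps)
  have "invertible_by ((\<delta> - \<epsilon> i) / 2) ((1 - g) * l) (a + (g * l) *\<^sub>R e i)"
    unfolding invertible_by_def
  proof (intro conjI ballI)
    have "unitized ((1 - g) * l) (a + (g * l) *\<^sub>R e i) ` X = unitized (1 - g) (g *\<^sub>R e i) ` (unitized l d ` X)"
      by (simp add: comp image_image)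
    then show "unitized ((1 - g) * l) (a + (g * l) *\<^sub>R e i) ` X = X"
      using invE invD by (simp add: invertible_by_def)
    fix v assume v: "v \<in> X"
    have "(\<delta> - \<epsilon> i) / 2 * norm v \<le> 1 / 2 * norm (unitized l d v)"
      using invD v by (auto simp: invertible_by_def)
    also have "\<dots> \<le> norm (unitized (1 - g) (g *\<^sub>R e i) (unitized l d v))"
      using invE unitized_in[OF v, of l d] unfolding invertible_by_def by blast
    finally show "(\<delta> - \<epsilon> i) / 2 * norm v \<le> norm (unitized ((1 - g) * l) (a + (g * l) *\<^sub>R e i) v)"
      by (simp add: comp)
  qed
  moreover obtain y' where y': "y' \<in> X" "unitized l d y' = w"
    using invD w(1) unfolding invertible_by_def by (metis imageE)
  moreover have "norm (y' - y) < \<eta>"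
  proof -
    interpret U: linear "unitized l d" by (rule linear_unitized)
    have "\<delta> / 2 * norm (y' - y) \<le> (\<delta> - \<epsilon> i) * norm (y' - y)"
      using i(2) by (intro mult_right_mono) auto
    also have "\<dots> \<le> norm (unitized l d (y' - y))"
      using invD subspace_diff[OF X_subspace y'(1) y(1)] by (auto simp: invertible_by_def)
    also have "unitized l d (y' - y) = (w - x) - (unitized l d y - unitized l a y)"
      by (simp add: U.diff y' y)
    also have "norm \<dots> \<le> \<rho> i + \<epsilon> i * norm y"
      by (intro order_trans[OF norm_triangle_ineq4] add_mono w diff)
    finally have "norm (y' - y) \<le> 2 / \<delta> * (\<epsilon> i * norm y + \<rho> i)"
      using inv(2) by (simp add: field_simps)
    then show ?thesis using i(1) by simp
  qed
  moreover have "(\<delta> - \<epsilon> i) / 2 > 0" using i(2) inv(2) by simp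
  ultimately show ?thesis using comp w(2) by metis
qed

text \<open>Iterating the step from \<open>b = 1\<close>, \<open>y = x\<close> gives elements \<open>b\<^sub>n = (1 - g)\<^sup>n + a\<^sub>n\<close> of the unitization with
  \<open>y\<^sub>n b\<^sub>n = x\<close>. The increments of \<open>a\<^sub>n\<close> and \<open>y\<^sub>n\<close> decay geometrically and the scalar part of \<open>b\<^sub>n\<close> tends to
  \<open>0\<close>, so in the limit \<open>y a = x\<close> with \<open>a\<close> in the algebra itself.\<close>

theorem cohen_factorization:
  assumes F: "F \<noteq> bot" and e: "\<And>i. norm (e i) \<le> M"
    and ax: "\<And>a. ((\<lambda>i. a * e i) \<longlongrightarrow> a) F" and xx: "((\<lambda>i. act x (e i)) \<longlongrightarrow> x) F" and x: "x \<in> X"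
  shows "\<exists>y\<in>X. \<exists>a. x = act y a"
proof -
  obtain L where L: "\<And>y a. norm (act y a) \<le> norm y * norm a * L" "L \<ge> 0"
    using nonneg_bounded by blast
  have M: "M \<ge> 0" using e norm_ge_zero order_trans by blast
  \<comment> \<open>One constant that is small enough for the operators \<open>(1 - g) + g e\<^sub>i\<close> both on the module and on the
    algebra.\<close>
  define g where "g = 1 / (2 * (1 + M + M * L))"
  have pos: "1 + M + M * L > 0" using M L(2) by (simp add: add_pos_nonneg)
  have g0: "g > 0" using pos by (simp add: g_def)
  have g: "0 \<le> g" "g * (1 + M * L) \<le> 1 / 2" "g * (1 + M) \<le> 1 / 2" "g \<le> 1 / 2"
    using M L(2) pos by (auto simp: g_def field_simps)
  define P where "P n s \<longleftrightarrow> snd s \<in> X \<and> unitized ((1 - g) ^ n) (fst s) (snd s) = x \<and>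
    (\<exists>\<delta>>0. invertible_by \<delta> ((1 - g) ^ n) (fst s))" for n s
  define Q where "Q n s t \<longleftrightarrow> norm (fst t - fst s) \<le> M * (1 - g) ^ n \<and>
    norm (snd t - snd s) \<le> (1 / 2) ^ n" for n :: nat and s t :: "'a \<times> 'x"
  have "\<exists>s. \<forall>n. P n (s n) \<and> Q n (s n) (s (Suc n))"
  proof (rule dependent_nat_choice)
    have "unitized 1 0 y = y" for y by (simp add: unitized_def zero_right)
    then have "P 0 (0, x)" using x by (auto simp: P_def invertible_by_def intro!: exI[of _ 1])
    then show "\<exists>s. P 0 s" by blast
  next
    fix s n assume P: "P n s"
    let ?l = "(1 - g) ^ n"
    obtain \<delta> where \<delta>: "\<delta> > 0" "invertible_by \<delta> ?l (fst s)" using P by (auto simp: P_def)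
    obtain i \<delta>' y' where n: "\<delta>' > 0" "invertible_by \<delta>' ((1 - g) * ?l) (fst s + (g * ?l) *\<^sub>R e i)"
      "y' \<in> X" "unitized ((1 - g) * ?l) (fst s + (g * ?l) *\<^sub>R e i) y' = x" "norm (y' - snd s) < (1 / 2) ^ n"
      using cohen_step[OF L e F ax xx x g(1-3) \<delta>(2,1), of "snd s" "(1 / 2) ^ n"] P
      by (auto simp: P_def)
    have "norm ((g * ?l) *\<^sub>R e i) \<le> 1 * ?l * M"
      unfolding norm_scaleR using g
      by (intro mult_mono e) (auto simp: abs_mult intro!: mult_right_mono)
    then have "Q n s (fst s + (g * ?l) *\<^sub>R e i, y')"
      using n by (simp add: Q_def mult_ac)
    moreover have "P (Suc n) (fst s + (g * ?l) *\<^sub>R e i, y')" using n by (auto simp: P_def)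
    ultimately show "\<exists>t. P (Suc n) t \<and> Q n s t" by blast
  qed
  then obtain s where s: "\<And>n. P n (s n)" "\<And>n. Q n (s n) (s (Suc n))" by blast
  have conv: "convergent f" if "\<And>n. norm (f (Suc n) - f n) \<le> C * r ^ n" "0 \<le> r" "r < 1"
    for f :: "nat \<Rightarrow> 'z::banach" and C r
  proof -
    have "summable (\<lambda>n. f (Suc n) - f n)"
      by (rule summable_comparison_test'[where N = 0, OF summable_mult[OF summable_geometric[of r]]])
        (use that in auto)
    then show ?thesis by (simp add: summable_iff_convergent sum_lessThan_telescope convergent_diff_const_right_iff)
  qed
  have "convergent (\<lambda>n. fst (s n))"
    by (rule conv[of _ M "1 - g"]) (use s(2) g g0 in \<open>auto simp: Q_def\<close>)
  then obtain a where a: "(\<lambda>n. fst (s n)) \<longlonglongrightarrow> a" by (auto simp: convergent_def)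
  have "convergent (\<lambda>n. snd (s n))"
    by (rule conv[of _ 1 "1 / 2"]) (use s(2) in \<open>auto simp: Q_def\<close>)
  then obtain y where y: "(\<lambda>n. snd (s n)) \<longlonglongrightarrow> y" by (auto simp: convergent_def)
  have "y \<in> X"
    using closed_sequentially[OF complete_imp_closed[OF X_complete] _ y] s(1) by (auto simp: P_def)
  moreover have "x = act y a"
  proof -
    have "(\<lambda>n. unitized ((1 - g) ^ n) (fst (s n)) (snd (s n))) \<longlonglongrightarrow> 0 *\<^sub>R y + act y a"
      unfolding unitized_def
      by (intro tendsto_add tendsto_scaleR tendsto a y LIMSEQ_power_zero) (use g g0 in auto)
    then have "(\<lambda>n. x) \<longlonglongrightarrow> act y a" using s(1) by (simp add: P_def)
    then show ?thesis by (simp add: LIMSEQ_const_iff)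
  qed
  ultimately show ?thesis by blast
qed

end


section \<open>The second dual module\<close>

lemma smul_in_dual: "f \<in> dual scl \<Longrightarrow> smul c f \<in> dual scl"
  by (simp add: dual_def smul_apply mult_ac)

lemma subspace_dual: "subspace (dual scl)"
  by (rule subspaceI)
    (auto simp: dual_def zero_blinfun.rep_eq plus_blinfun.rep_eq scaleR_blinfun.rep_eq distrib_left)

lemma closed_dual: "closed (dual scl)"
  unfolding dual_def
  by (intro closed_Collect_all closed_Collect_eq continuous_intros)

lemma complete_dual: "complete (dual scl)"
  by (simp add: complete_eq_closed closed_dual)

lemma restrict_in_bidual:
  assumes \<phi>: "bounded_linear \<phi>" and smul: "\<And>c f. \<phi> (smul c f) = c * \<phi> f"
  shows "restrict \<phi> (dual scl) \<in> bidual scl"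
proof -
  interpret \<phi>: bounded_linear \<phi> by (rule \<phi>)
  obtain K where "\<And>f. norm (\<phi> f) \<le> norm f * K" using \<phi>.bounded by blast
  then show ?thesis
    using subspace_add[OF subspace_dual[of scl]] smul_in_dual[of _ scl] smul
    by (auto simp: bidual_def \<phi>.add smul_def mult.commute intro!: exI[of _ K])
qed

context left_banach_module
begin

lemma bounded_bilinear_adj1: "bounded_bilinear (adj1 act :: ('b \<Rightarrow>\<^sub>L 'k) \<Rightarrow> 'a \<Rightarrow> _)"
proof
  fix f f' :: "'b \<Rightarrow>\<^sub>L 'k" and a a' r
  show "adj1 act (f + f') a = adj1 act f a + adj1 act f' a"
    by (rule blinfun_eqI) (simp add: adj1_apply plus_blinfun.rep_eq)
  show "adj1 act f (a + a') = adj1 act f a + adj1 act f a'"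
    by (rule blinfun_eqI) (simp add: adj1_apply plus_blinfun.rep_eq add_left blinfun.add_right)
  show "adj1 act (r *\<^sub>R f) a = r *\<^sub>R adj1 act f a"
    by (rule blinfun_eqI) (simp add: adj1_apply scaleR_blinfun.rep_eq)
  show "adj1 act f (r *\<^sub>R a) = r *\<^sub>R adj1 act f a"
    by (rule blinfun_eqI) (simp add: adj1_apply scaleR_blinfun.rep_eq scaleR_left blinfun.scaleR_right)
next
  obtain L where L: "\<And>a b. norm (act a b) \<le> norm a * norm b * L" "L \<ge> 0"
    using nonneg_bounded by blast
  have "norm (adj1 act f a) \<le> norm f * norm a * L" for f :: "'b \<Rightarrow>\<^sub>L 'k" and a
  proof (rule norm_blinfun_bound)
    fix b
    have "norm (blinfun_apply f (act a b)) \<le> norm f * (norm a * norm b * L)"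
      by (rule order_trans[OF norm_blinfun]) (intro mult_left_mono L norm_ge_zero)
    then show "norm (blinfun_apply (adj1 act f a) b) \<le> norm f * norm a * L * norm b"
      by (simp add: adj1_apply mult_ac)
  qed (use L(2) in simp)
  then show "\<exists>K. \<forall>f a. norm (adj1 act f a :: 'b \<Rightarrow>\<^sub>L 'k) \<le> norm f * norm a * K" by blast
qed

lemma adj1_adj1: "adj1 act (adj1 act f a) a' = adj1 act f (a * a')"
  for f :: "'b \<Rightarrow>\<^sub>L 'k"
  by (rule blinfun_eqI) (simp add: adj1_apply act_mult)

lemma adj1_smul: "adj1 act (smul c f) a = smul c (adj1 act f a)"
  for f :: "'b \<Rightarrow>\<^sub>L 'k"
  by (rule blinfun_eqI) (simp add: adj1_apply smul_apply)

lemma right_action_dual: "right_action (adj1 act) (dual scaleB)"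
  by (intro right_action.intro right_action_axioms.intro bounded_bilinear_adj1 adj1_adj1
      complete_dual subspace_dual adj1_in_dual)

text \<open>If \<open>\<phi>\<close> vanishes on \<open>B\<^sup>*A\<close>, then \<open>\<pi>\<^sup>*\<^sup>*(\<phi>, f) = 0\<close> for every \<open>f\<close>; applying the left unit to this
  functional returns \<open>\<phi> f\<close>.\<close>

lemma annihilator_dual_times:
  assumes e'': "left_unit scaleA scaleB act e''"
  shows "annihilator scaleB (dual_times scaleB act) = {bidual_zero scaleB}"
proof (intro equalityI subsetI)
  fix \<phi> assume "\<phi> \<in> annihilator scaleB (dual_times scaleB act)"
  then have \<phi>: "\<phi> \<in> bidual scaleB" and ann: "\<And>f a. f \<in> dual scaleB \<Longrightarrow> \<phi> (adj1 act f a) = 0"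
    by (auto simp: annihilator_def dual_times_def)
  have zero: "e'' 0 = 0"
  proof -
    have "e'' (0 + 0) = e'' 0 + e'' 0"
      using e'' subspace_0[OF subspace_dual] unfolding left_unit_def bidual_def by blast
    then show ?thesis by simp
  qed
  have "\<phi> f = 0" if f: "f \<in> dual scaleB" for f
  proof -
    have "adj2 act \<phi> f = 0"
      by (rule blinfun_eqI) (simp add: adj2_apply[OF \<phi> f] ann[OF f])
    then have "adj3 scaleB act e'' \<phi> f = 0" using f zero by (simp add: adj3_def)
    then show ?thesis using e'' \<phi> by (simp add: left_unit_def)
  qed
  moreover have "\<phi> \<in> extensional (dual scaleB)" using \<phi> by (simp add: bidual_def)
  ultimately show "\<phi> \<in> {bidual_zero scaleB}"
    by (auto simp: bidual_zero_def fun_eq_iff extensional_def)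
next
  fix \<phi> assume "\<phi> \<in> {bidual_zero scaleB}"
  moreover have "bidual_zero scaleB \<in> bidual scaleB"
    unfolding bidual_zero_def by (rule restrict_in_bidual) (auto simp: bounded_linear_zero)
  ultimately show "\<phi> \<in> annihilator scaleB (dual_times scaleB act)"
    by (auto simp: annihilator_def dual_times_def bidual_zero_def adj1_in_dual)
qed

text \<open>The functionals with the claimed property form a subspace that contains \<open>B\<^sup>*A\<close>. If \<open>f\<close> were outside its
  closure, a separating functional would be a nonzero element of \<open>(B\<^sup>*A)\<^sup>\<bottom>\<close>.\<close>

lemma dual_approximate_identity:
  assumes e: "bounded_approximate_identity e F"
    and ann: "annihilator scaleB (dual_times scaleB act) = {bidual_zero scaleB}"
    and f: "f \<in> dual scaleB"
  shows "((\<lambda>i. adj1 act f (e i)) \<longlongrightarrow> f) F"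
proof -
  interpret D: bounded_bilinear "adj1 act :: ('b \<Rightarrow>\<^sub>L 'k) \<Rightarrow> 'a \<Rightarrow> _" by (rule bounded_bilinear_adj1)
  interpret sm: bounded_bilinear "smul :: 'k \<Rightarrow> ('b \<Rightarrow>\<^sub>L 'k) \<Rightarrow> _" by (rule bounded_bilinear_smul)
  obtain M where M: "\<And>i. norm (e i) \<le> M" and ae: "\<And>a. ((\<lambda>i. a * e i) \<longlongrightarrow> a) F"
    using e unfolding bounded_approximate_identity_def by blast
  obtain L where L: "\<And>g a. norm (adj1 act g a :: 'b \<Rightarrow>\<^sub>L 'k) \<le> norm g * norm a * L" "L \<ge> 0"
    using D.nonneg_bounded by blast
  define S where "S = {g \<in> dual scaleB. ((\<lambda>i. adj1 act g (e i)) \<longlongrightarrow> g) F}"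
  have S_sub: "subspace S"
  proof (rule subspaceI)
    show "0 \<in> S" using subspace_0[OF subspace_dual] by (simp add: S_def D.zero_left)
    show "x + y \<in> S" if "x \<in> S" "y \<in> S" for x y
      using that subspace_add[OF subspace_dual] by (auto simp: S_def D.add_left intro!: tendsto_add)
    show "r *\<^sub>R x \<in> S" if "x \<in> S" for r x
      using that subspace_scale[OF subspace_dual]
      by (auto simp: S_def D.scaleR_left intro!: tendsto_scaleR)
  qed
  have S_smul: "smul c s \<in> S" if "s \<in> S" for c s
    using that by (auto simp: S_def adj1_smul smul_in_dual intro!: sm.tendsto)
  \<comment> \<open>Here the approximate identity of the algebra enters: \<open>(g a) e\<^sub>i = g (a e\<^sub>i)\<close>.\<close>
  have S_act: "adj1 act g a \<in> S" if "g \<in> dual scaleB" for g a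
    using that D.tendsto[OF tendsto_const ae[of a], of g] by (simp add: S_def adj1_in_dual adj1_adj1)
  have "f \<in> closure S"
  proof (rule ccontr)
    assume "f \<notin> closure S"
    then obtain \<phi> where \<phi>: "bounded_linear \<phi>" "\<And>c g. \<phi> (smul c g) = c * \<phi> g"
      "\<And>s. s \<in> S \<Longrightarrow> \<phi> s = 0" "\<phi> f \<noteq> 0"
      using ex_scalar_functional_separating[OF S_sub S_smul] by blast
    have "restrict \<phi> (dual scaleB) \<in> annihilator scaleB (dual_times scaleB act)"
      using restrict_in_bidual[OF \<phi>(1,2)] \<phi>(3) S_act
      by (auto simp: annihilator_def dual_times_def adj1_in_dual)
    then have "restrict \<phi> (dual scaleB) f = bidual_zero scaleB f" using ann by simp
    then show False using f \<phi>(4) by (simp add: bidual_zero_def)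
  qed
  \<comment> \<open>The operators \<open>g \<mapsto> g e\<^sub>i\<close> are uniformly bounded, so convergence passes from \<open>S\<close> to its closure.\<close>
  show ?thesis
  proof (rule tendstoI)
    fix \<epsilon> :: real assume \<epsilon>: "\<epsilon> > 0"
    have M0: "M \<ge> 0" using M norm_ge_zero order_trans by blast
    define \<eta> where "\<eta> = \<epsilon> / (2 * (M * L + 1))"
    have pos: "M * L + 1 > 0" using M0 L(2) by (simp add: add_nonneg_pos)
    then have \<eta>: "\<eta> > 0" using \<epsilon> by (simp add: \<eta>_def)
    obtain s where s: "s \<in> S" "dist s f < \<eta>"
      using \<open>f \<in> closure S\<close> \<eta> unfolding closure_approachable by blast
    have "\<forall>\<^sub>F i in F. dist (adj1 act s (e i)) s < \<epsilon> / 2"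
      using s(1) \<epsilon> by (intro tendstoD) (auto simp: S_def)
    then show "\<forall>\<^sub>F i in F. dist (adj1 act f (e i)) f < \<epsilon>"
    proof eventually_elim
      case (elim i)
      have "norm (adj1 act (f - s) (e i)) \<le> norm (f - s) * M * L"
        by (rule order_trans[OF L(1)]) (intro mult_right_mono mult_left_mono M L(2) norm_ge_zero)
      then have "norm (adj1 act f (e i) - adj1 act s (e i)) + norm (s - f) \<le> norm (f - s) * (M * L + 1)"
        by (simp add: D.diff_left norm_minus_commute[of s f] algebra_simps)
      also have "\<dots> < \<eta> * (M * L + 1)"
        using s(2) pos by (intro mult_strict_right_mono) (auto simp: dist_norm norm_minus_commute)
      also have "\<dots> = \<epsilon> / 2" using pos by (simp add: \<eta>_def field_simps)
      finally show ?case
        using elim norm_triangle_ineq[of "adj1 act f (e i) - adj1 act s (e i)" "adj1 act s (e i) - s"]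
          norm_triangle_ineq[of "adj1 act f (e i) - s" "s - f"]
        by (simp add: dist_norm)
    qed
  qed
qed

lemma factors_on_left_if_annihilator_trivial:
  fixes e :: "'i \<Rightarrow> 'a"
  assumes e: "bounded_approximate_identity e F"
    and ann: "annihilator scaleB (dual_times scaleB act) = {bidual_zero scaleB}"
  shows "factors_on_left scaleB act"
proof -
  interpret D: right_action "adj1 act :: ('b \<Rightarrow>\<^sub>L 'k) \<Rightarrow> 'a \<Rightarrow> _" "dual scaleB"
    by (rule right_action_dual)
  obtain M where M: "\<And>i. norm (e i) \<le> M" and F: "F \<noteq> bot" and ae: "\<And>a. ((\<lambda>i. a * e i) \<longlongrightarrow> a) F"
    using e unfolding bounded_approximate_identity_def by blast
  have "f \<in> dual_times scaleB act" if "f \<in> dual scaleB" for f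
    using D.cohen_factorization[OF F M ae dual_approximate_identity[OF e ann that] that]
    by (auto simp: dual_times_def)
  then show ?thesis
    by (auto simp: factors_on_left_def dual_times_def adj1_in_dual)
qed

end

theorem mainTheorem3:
  fixes scaleA :: "'k::{real_normed_field,euclidean_space} \<Rightarrow> 'a::{real_normed_algebra,banach} \<Rightarrow> 'a"
    and scaleB :: "'k \<Rightarrow> 'b::banach \<Rightarrow> 'b"
    and act :: "'a \<Rightarrow> 'b \<Rightarrow> 'b"
    and e :: "'i \<Rightarrow> 'a"
    and F :: "'i filter"
  assumes "left_banach_module scaleA scaleB act"
    and "bounded_approximate_identity e F"
  shows "(factors_on_left scaleB act \<and> (\<exists>e''. left_unit scaleA scaleB act e'') \<longrightarrow>
            annihilator scaleB (dual_times scaleB act) = {bidual_zero scaleB}) \<and>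
         (\<not> factors_on_left scaleB act \<longrightarrow>
            (\<forall>e''. left_unit scaleA scaleB act e'' \<longrightarrow>
               e'' \<notin> topological_centre scaleA scaleB act))"
proof -
  interpret left_banach_module scaleA scaleB act by (rule assms(1))
  \<comment> \<open>A left unit makes the annihilator trivial, which contradicts the failure of factorization in the
    second part.\<close>
  show ?thesis
    using annihilator_dual_times factors_on_left_if_annihilator_trivial[OF assms(2)] by blast
qed

end
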